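(* Let $(G,\cdot)$ be a finite Smarandache loop with $n$ distinct S-subgroups $H_1,\dots,H_n$. For each $i$ let $SBS_i(G,\cdot)$ denote the Smarandache Bryant-Schneider group of $(G,\cdot)$ relative to the S-subgroup $(H_i,\cdot)$. Then $$|BS(G,\cdot)|=\frac{1}{n}\sum_{i=1}^n|SBS_i(G,\cdot)|\,[BS(G,\cdot):SBS_i(G,\cdot)].$$
   Context: A loop is a quasigroup with two-sided identity $e$. A Smarandache loop (S-loop) is a loop $(G,\cdot)$ having a subset $H$ such that $(H,\cdot)$ is a non-trivial subgroup (a subloop that is a group, $\{e\}\ne H\ne G$); $H$ is called an S-subgroup. Maps are written on the right and composed left to right. $SYM(G,\cdot)$ is the group of all bijections of $G$; $yL_x=x\cdot y$, $yR_x=y\cdot x$. $AUT(G,\cdot)$ is the group of autotopisms, i.e. triples $(U,V,W)\in SYM(G)^3$ with $xU\cdot yV=(x\cdot y)W$ for all $x,y\in G$. $BS(G,\cdot)=\{\theta\in SYM(G,\cdot): \exists f,g\in G,\ (\theta R_g^{-1},\theta L_f^{-1},\theta)\in AUT(G,\cdot)\}$, a group under composition. Relative to an S-subgroup $H$: $SSYM(G,\cdot)$ consists of all $\theta\in SYM(G,\cdot)$ with $h\theta\in H$ for all $h\in H$, and the Smarandache Bryant-Schneider group is $SBS(G,\cdot)=\{\theta\in SSYM(G,\cdot): \exists f,g\in H,\ (\theta R_g^{-1},\theta L_f^{-1},\theta)\in AUT(G,\cdot)\}$, a subgroup of $BS(G,\cdot)$. $[A:B]$ denotes the index of a subgroup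 $B$ in $A$. *)

theory Defs
  imports Complex_Main "HOL-Algebra.Coset" "HOL-Algebra.Bij"
begin

locale loop =
  fixes G (structure)
  assumes m_closed: "\<lbrakk>x \<in> carrier G; y \<in> carrier G\<rbrakk> \<Longrightarrow> x \<otimes> y \<in> carrier G"
    and one_closed: "\<one> \<in> carrier G"
    and l_one: "x \<in> carrier G \<Longrightarrow> \<one> \<otimes> x = x"
    and r_one: "x \<in> carrier G \<Longrightarrow> x \<otimes> \<one> = x"
    and l_div: "\<lbrakk>a \<in> carrier G; b \<in> carrier G\<rbrakk> \<Longrightarrow> \<exists>!x. x \<in> carrier G \<and> a \<otimes> x = b"
    and r_div: "\<lbrakk>a \<in> carrier G; b \<in> carrier G\<rbrakk> \<Longrightarrow> \<exists>!y. y \<in> carrier G \<and> y \<otimes> a = b"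

definition subloop :: "'a set \<Rightarrow> ('a, 'b) monoid_scheme \<Rightarrow> bool" where
  "subloop H G \<longleftrightarrow> H \<subseteq> carrier G \<and> loop (G\<lparr>carrier := H\<rparr>)"

definition S_subgroup :: "'a set \<Rightarrow> ('a, 'b) monoid_scheme \<Rightarrow> bool" where
  "S_subgroup H G \<longleftrightarrow>
     subloop H G \<and> group (G\<lparr>carrier := H\<rparr>) \<and> H \<noteq> {\<one>\<^bsub>G\<^esub>} \<and> H \<noteq> carrier G"

definition S_loop :: "('a, 'b) monoid_scheme \<Rightarrow> bool" where
  "S_loop G \<longleftrightarrow> loop G \<and> (\<exists>H. S_subgroup H G)"

text \<open>
  Maps act on the right, so the product of \<open>\<alpha>\<close> and \<open>\<beta>\<close> applies \<open>\<alpha>\<close> first; this is the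
  opposite of the multiplication of \<^const>\<open>BijGroup\<close>. As in \<^const>\<open>Bij\<close>, permutations of
  the carrier are represented by extensional functions, so distinct elements of the
  carrier are distinct permutations and cardinalities are meaningful.
\<close>

definition SYM :: "('a, 'b) monoid_scheme \<Rightarrow> ('a \<Rightarrow> 'a) monoid" where
  "SYM G = \<lparr>carrier = Bij (carrier G),
            mult = (\<lambda>\<alpha> \<beta>. compose (carrier G) \<beta> \<alpha>),
            one = (\<lambda>x\<in>carrier G. x)\<rparr>"

definition L_map :: "('a, 'b) monoid_scheme \<Rightarrow> 'a \<Rightarrow> 'a \<Rightarrow> 'a" where
  "L_map G x = (\<lambda>y\<in>carrier G. x \<otimes>\<^bsub>G\<^esub> y)"

definition R_map :: "('a, 'b) monoid_scheme \<Rightarrow> 'a \<Rightarrow> 'a \<Rightarrow> 'a" where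
  "R_map G x = (\<lambda>y\<in>carrier G. y \<otimes>\<^bsub>G\<^esub> x)"

definition AUT :: "('a, 'b) monoid_scheme \<Rightarrow> (('a \<Rightarrow> 'a) \<times> ('a \<Rightarrow> 'a) \<times> ('a \<Rightarrow> 'a)) set" where
  "AUT G = {(U, V, W).
     U \<in> carrier (SYM G) \<and> V \<in> carrier (SYM G) \<and> W \<in> carrier (SYM G) \<and>
     (\<forall>x\<in>carrier G. \<forall>y\<in>carrier G. U x \<otimes>\<^bsub>G\<^esub> V y = W (x \<otimes>\<^bsub>G\<^esub> y))}"

definition BS :: "('a, 'b) monoid_scheme \<Rightarrow> ('a \<Rightarrow> 'a) set" where
  "BS G = {\<theta> \<in> carrier (SYM G). \<exists>f\<in>carrier G. \<exists>g\<in>carrier G.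
     (\<theta> \<otimes>\<^bsub>SYM G\<^esub> inv\<^bsub>SYM G\<^esub> (R_map G g), \<theta> \<otimes>\<^bsub>SYM G\<^esub> inv\<^bsub>SYM G\<^esub> (L_map G f), \<theta>) \<in> AUT G}"

definition BS_group :: "('a, 'b) monoid_scheme \<Rightarrow> ('a \<Rightarrow> 'a) monoid" where
  "BS_group G = (SYM G)\<lparr>carrier := BS G\<rparr>"

definition SSYM :: "('a, 'b) monoid_scheme \<Rightarrow> 'a set \<Rightarrow> ('a \<Rightarrow> 'a) set" where
  "SSYM G H = {\<theta> \<in> carrier (SYM G). \<forall>h\<in>H. \<theta> h \<in> H}"

definition SBS :: "('a, 'b) monoid_scheme \<Rightarrow> 'a set \<Rightarrow> ('a \<Rightarrow> 'a) set" where
  "SBS G H = {\<theta> \<in> SSYM G H. \<exists>f\<in>H. \<exists>g\<in>H.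
     (\<theta> \<otimes>\<^bsub>SYM G\<^esub> inv\<^bsub>SYM G\<^esub> (R_map G g), \<theta> \<otimes>\<^bsub>SYM G\<^esub> inv\<^bsub>SYM G\<^esub> (L_map G f), \<theta>) \<in> AUT G}"

definition subgroup_index :: "('a, 'b) monoid_scheme \<Rightarrow> 'a set \<Rightarrow> nat" where
  "subgroup_index A B = card (rcosets\<^bsub>A\<^esub> B)"

end

theory Submission
  imports Defs
begin

text \<open>
  Each summand is \<open>|BS(G)|\<close> by Lagrange's theorem, once \<open>SBS\<close> is known to be a subgroup of
  \<open>BS\<close>. For this, evaluate an autotopism \<open>(U, V, \<theta>)\<close> at pairs containing the identity: it forces
  \<open>U = \<theta>R\<^sub>g\<^sup>-\<^sup>1\<close> and \<open>V = \<theta>L\<^sub>f\<^sup>-\<^sup>1\<close> with \<open>f = eU\<close> and \<open>g = eV\<close>. Hence \<open>BS\<close> is the projection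
  of \<open>AUT\<close> to the third component, and \<open>SBS\<close> adds the conditions \<open>H\<theta> \<subseteq> H\<close>, \<open>eU \<in> H\<close>,
  \<open>eV \<in> H\<close>. By division in \<open>H\<close>, these make \<open>U\<close> and \<open>V\<close> preserve \<open>H\<close>, so they are stable
  under composition; since \<open>G\<close> is finite, this suffices.
\<close>

text \<open>Left multiplication by \<open>x\<close> is injective on \<open>K\<close> and maps it
  into itself, so by finiteness it permutes \<open>K\<close>. Solving
  \<open>x \<otimes> y = x\<close> in \<open>K\<close> yields the identity, and solving
  \<open>x \<otimes> z = \<one>\<close> then yields the inverse.\<close>

lemma (in group) finite_closed_imp_subgroup:
  assumes "finite K" "K \<subseteq> carrier G" "K \<noteq> {}"
    and closed: "\<And>x y. x \<in> K \<Longrightarrow> y \<in> K \<Longrightarrow> x \<otimes> y \<in> K"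
  shows "subgroup K G"
proof (rule subgroupI)
  fix x assume x: "x \<in> K"
  have inj: "inj_on ((\<otimes>) x) K"
    by (rule inj_onI) (metis Units_eq Units_l_cancel subsetD[OF assms(2)] x)
  have surj: "(\<otimes>) x ` K = K"
    by (rule endo_inj_surj[OF assms(1) _ inj]) (use x closed in auto)
  obtain y where y: "y \<in> K" "x \<otimes> y = x"
    using surj x by (metis imageE)
  then have "y = \<one>"
    using x assms(2) by (metis l_cancel_one subsetD)
  then obtain z where z: "z \<in> K" "x \<otimes> z = \<one>"
    using surj y by (metis imageE)
  then have "inv x = z"
    using x assms(2) by (metis inv_equality inv_comm subsetD)
  with z show "inv x \<in> K" by simp
qed (use assms in auto)

section \<open>Permutation groups and translations\<close>

lemma SYM_simps:
  "carrier (SYM G) = Bij (carrier G)"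
  "\<alpha> \<otimes>\<^bsub>SYM G\<^esub> \<beta> = compose (carrier G) \<beta> \<alpha>"
  "\<one>\<^bsub>SYM G\<^esub> = (\<lambda>x\<in>carrier G. x)"
  by (simp_all add: SYM_def)

lemma SYM_group: "group (SYM G)"
proof (rule groupI)
  fix x assume x: "x \<in> carrier (SYM G)"
  \<comment> \<open>The product applies its left factor first, so a left inverse is a function that
    \<open>x\<close> undoes afterwards: \<open>inv_into\<close>, restricted to stay
    extensional.\<close>
  then have "compose (carrier G) x (restrict (inv_into (carrier G) x) (carrier G)) =
      (\<lambda>y\<in>carrier G. y)"
    by (auto simp: SYM_simps Bij_def compose_def bij_betw_inv_into_right intro!: restrict_ext)
  then show "\<exists>y\<in>carrier (SYM G). y \<otimes>\<^bsub>SYM G\<^esub> x = \<one>\<^bsub>SYM G\<^esub>"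
    using x restrict_inv_into_Bij by (auto simp: SYM_simps)
qed (auto simp: SYM_simps compose_Bij id_Bij Bij_imp_funcset Bij_imp_extensional compose_assoc
    compose_Id[OF Bij_imp_funcset Bij_imp_extensional])

lemma SYM_closed: "\<alpha> \<in> carrier (SYM G) \<Longrightarrow> x \<in> carrier G \<Longrightarrow> \<alpha> x \<in> carrier G"
  using Bij_imp_funcset by (auto simp: SYM_simps)

lemma SYM_mult_apply: "x \<in> carrier G \<Longrightarrow> (\<alpha> \<otimes>\<^bsub>SYM G\<^esub> \<beta>) x = \<beta> (\<alpha> x)"
  by (simp add: SYM_simps compose_def)

lemma SYM_eqI:
  assumes "\<alpha> \<in> carrier (SYM G)" "\<beta> \<in> carrier (SYM G)"
    and "\<And>x. x \<in> carrier G \<Longrightarrow> \<alpha> x = \<beta> x"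
  shows "\<alpha> = \<beta>"
  using assms by (auto simp: SYM_simps Bij_def intro: extensionalityI[where A = "carrier G"])

lemma finite_SYM:
  assumes "finite (carrier G)"
  shows "finite (carrier (SYM G))"
proof (rule finite_subset)
  show "carrier (SYM G) \<subseteq> carrier G \<rightarrow>\<^sub>E carrier G"
    using Bij_imp_funcset Bij_imp_extensional by (auto simp: SYM_simps PiE_def)
  show "finite (carrier G \<rightarrow>\<^sub>E carrier G)"
    using assms by (intro finite_PiE)
qed

context loop
begin

lemma l_cancel:
  assumes "x \<in> carrier G" "y \<in> carrier G" "z \<in> carrier G" "x \<otimes> y = x \<otimes> z"
  shows "y = z"
  using assms l_div[of x "x \<otimes> y"] m_closed by metis

lemma r_cancel:
  assumes "x \<in> carrier G" "y \<in> carrier G" "z \<in> carrier G" "y \<otimes> x = z \<otimes> x"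
  shows "y = z"
  using assms r_div[of x "y \<otimes> x"] m_closed by metis

lemma R_map_SYM:
  assumes g: "g \<in> carrier G"
  shows "R_map G g \<in> carrier (SYM G)"
proof -
  have "bij_betw (R_map G g) (carrier G) (carrier G)"
  proof (rule bij_betwI')
    show "R_map G g x = R_map G g y \<longleftrightarrow> x = y" if "x \<in> carrier G" "y \<in> carrier G" for x y
      using r_cancel[OF g that] that by (auto simp: R_map_def)
    show "R_map G g x \<in> carrier G" if "x \<in> carrier G" for x
      using that g by (simp add: R_map_def m_closed)
    show "\<exists>x\<in>carrier G. y = R_map G g x" if "y \<in> carrier G" for y
      using ex1_implies_ex[OF r_div[OF g that]] by (auto simp: R_map_def)
  qed
  then show ?thesis
    by (simp add: SYM_simps Bij_def R_map_def)
qed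

lemma L_map_SYM:
  assumes f: "f \<in> carrier G"
  shows "L_map G f \<in> carrier (SYM G)"
proof -
  have "bij_betw (L_map G f) (carrier G) (carrier G)"
  proof (rule bij_betwI')
    show "L_map G f x = L_map G f y \<longleftrightarrow> x = y" if "x \<in> carrier G" "y \<in> carrier G" for x y
      using l_cancel[OF f that] that by (auto simp: L_map_def)
    show "L_map G f x \<in> carrier G" if "x \<in> carrier G" for x
      using that f by (simp add: L_map_def m_closed)
    show "\<exists>x\<in>carrier G. y = L_map G f x" if "y \<in> carrier G" for y
      using ex1_implies_ex[OF l_div[OF f that]] by (auto simp: L_map_def)
  qed
  then show ?thesis
    by (simp add: SYM_simps Bij_def L_map_def)
qed

section \<open>The Bryant-Schneider group as a projection of the autotopism group\<close>

text \<open>With \<open>\<one>\<close> as second argument the autotopism law says that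
  \<open>\<theta>\<close> is \<open>U\<close> followed by right translation by
  \<open>V \<one>\<close>; with \<open>\<one>\<close> as first argument, \<open>V\<close> followed
  by left translation by \<open>U \<one>\<close>. Cancelling the translations in
  \<open>SYM G\<close> gives the formulas.\<close>

lemma AUT_factor:
  assumes "(U, V, \<theta>) \<in> AUT G"
  shows "U = \<theta> \<otimes>\<^bsub>SYM G\<^esub> inv\<^bsub>SYM G\<^esub> R_map G (V \<one>)"
    and "V = \<theta> \<otimes>\<^bsub>SYM G\<^esub> inv\<^bsub>SYM G\<^esub> L_map G (U \<one>)"
proof -
  interpret S: group "SYM G" by (rule SYM_group)
  have UV: "U \<in> carrier (SYM G)" "V \<in> carrier (SYM G)" "\<theta> \<in> carrier (SYM G)"
    and mult: "\<And>x y. x \<in> carrier G \<Longrightarrow> y \<in> carrier G \<Longrightarrow> U x \<otimes> V y = \<theta> (x \<otimes> y)"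
    using assms by (auto simp: AUT_def)
  have U1: "U \<one> \<in> carrier G" and V1: "V \<one> \<in> carrier G"
    using SYM_closed[OF _ one_closed] UV by blast+
  have "\<theta> = U \<otimes>\<^bsub>SYM G\<^esub> R_map G (V \<one>)"
  proof (rule SYM_eqI)
    show "\<theta> x = (U \<otimes>\<^bsub>SYM G\<^esub> R_map G (V \<one>)) x" if x: "x \<in> carrier G" for x
      using mult[OF x one_closed] by (simp add: SYM_mult_apply R_map_def r_one x SYM_closed[OF UV(1)])
  qed (use UV R_map_SYM[OF V1] in simp_all)
  then show "U = \<theta> \<otimes>\<^bsub>SYM G\<^esub> inv\<^bsub>SYM G\<^esub> R_map G (V \<one>)"
    by (rule iffD2[OF S.inv_solve_right[OF UV(1) UV(3) R_map_SYM[OF V1]]])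
  have "\<theta> = V \<otimes>\<^bsub>SYM G\<^esub> L_map G (U \<one>)"
  proof (rule SYM_eqI)
    show "\<theta> x = (V \<otimes>\<^bsub>SYM G\<^esub> L_map G (U \<one>)) x" if x: "x \<in> carrier G" for x
      using mult[OF one_closed x] by (simp add: SYM_mult_apply L_map_def l_one x SYM_closed[OF UV(2)])
  qed (use UV L_map_SYM[OF U1] in simp_all)
  then show "V = \<theta> \<otimes>\<^bsub>SYM G\<^esub> inv\<^bsub>SYM G\<^esub> L_map G (U \<one>)"
    by (rule iffD2[OF S.inv_solve_right[OF UV(2) UV(3) L_map_SYM[OF U1]]])
qed

text \<open>The translation parameters are determined by the autotopism. At \<open>\<one>\<close>,
  undoing the inverse translations gives \<open>?U \<one> \<otimes> g = \<theta> \<one> = f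
  \<otimes> ?V \<one>\<close>, while the autotopism law gives
  \<open>\<theta> \<one> = ?U \<one> \<otimes> ?V \<one>\<close>; cancel on each side.\<close>

lemma AUT_one:
  assumes f: "f \<in> carrier G" and g: "g \<in> carrier G"
    and A: "(\<theta> \<otimes>\<^bsub>SYM G\<^esub> inv\<^bsub>SYM G\<^esub> R_map G g, \<theta> \<otimes>\<^bsub>SYM G\<^esub> inv\<^bsub>SYM G\<^esub> L_map G f, \<theta>) \<in> AUT G"
      (is "(?U, ?V, \<theta>) \<in> _")
  shows "?U \<one> = f" "?V \<one> = g"
proof -
  interpret S: group "SYM G" by (rule SYM_group)
  have UV: "?U \<in> carrier (SYM G)" "?V \<in> carrier (SYM G)" "\<theta> \<in> carrier (SYM G)"
    and mult: "\<And>x y. x \<in> carrier G \<Longrightarrow> y \<in> carrier G \<Longrightarrow> ?U x \<otimes> ?V y = \<theta> (x \<otimes> y)"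
    using A by (auto simp: AUT_def)
  note closed = SYM_closed[OF UV(1) one_closed] SYM_closed[OF UV(2) one_closed]
  have "?U \<otimes>\<^bsub>SYM G\<^esub> R_map G g = \<theta>" "?V \<otimes>\<^bsub>SYM G\<^esub> L_map G f = \<theta>"
    using UV R_map_SYM[OF g] L_map_SYM[OF f] by (simp_all add: S.m_assoc)
  then have "R_map G g (?U \<one>) = \<theta> \<one>" "L_map G f (?V \<one>) = \<theta> \<one>"
    by (metis SYM_mult_apply one_closed)+
  then have "?U \<one> \<otimes> g = ?U \<one> \<otimes> ?V \<one>" "f \<otimes> ?V \<one> = ?U \<one> \<otimes> ?V \<one>"
    using mult[OF one_closed one_closed] r_one[OF one_closed] closed
    unfolding R_map_def L_map_def by simp_all
  then show "?U \<one> = f" "?V \<one> = g"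
    using l_cancel[OF closed(1) g closed(2)] r_cancel[OF closed(2) f closed(1)] by metis+
qed

text \<open>Stated for an arbitrary subset \<open>K\<close> so as to serve both groups:
  \<open>K = carrier G\<close> for \<open>BS\<close>, an S-subgroup for \<open>SBS\<close>.\<close>

lemma BS_translations_iff:
  assumes "K \<subseteq> carrier G"
  shows "(\<exists>f\<in>K. \<exists>g\<in>K. (\<theta> \<otimes>\<^bsub>SYM G\<^esub> inv\<^bsub>SYM G\<^esub> R_map G g,
            \<theta> \<otimes>\<^bsub>SYM G\<^esub> inv\<^bsub>SYM G\<^esub> L_map G f, \<theta>) \<in> AUT G) \<longleftrightarrow>
         (\<exists>U V. (U, V, \<theta>) \<in> AUT G \<and> U \<one> \<in> K \<and> V \<one> \<in> K)"
proof (intro iffI; elim bexE exE conjE)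
  fix f g
  assume A: "f \<in> K" "g \<in> K" "(\<theta> \<otimes>\<^bsub>SYM G\<^esub> inv\<^bsub>SYM G\<^esub> R_map G g,
      \<theta> \<otimes>\<^bsub>SYM G\<^esub> inv\<^bsub>SYM G\<^esub> L_map G f, \<theta>) \<in> AUT G"
  have "f \<in> carrier G" "g \<in> carrier G"
    using A assms by auto
  note one = AUT_one[OF this A(3)]
  show "\<exists>U V. (U, V, \<theta>) \<in> AUT G \<and> U \<one> \<in> K \<and> V \<one> \<in> K"
    by (rule exI, rule exI, rule conjI[OF A(3)]) (simp add: one A(1,2))
next
  fix U V
  assume A: "(U, V, \<theta>) \<in> AUT G" "U \<one> \<in> K" "V \<one> \<in> K"
  note factor = AUT_factor[OF A(1), symmetric]
  show "\<exists>f\<in>K. \<exists>g\<in>K. (\<theta> \<otimes>\<^bsub>SYM G\<^esub> inv\<^bsub>SYM G\<^esub> R_map G g,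
      \<theta> \<otimes>\<^bsub>SYM G\<^esub> inv\<^bsub>SYM G\<^esub> L_map G f, \<theta>) \<in> AUT G"
    \<comment> \<open>The witnesses are \<open>f = U \<one>\<close> and \<open>g = V \<one>\<close>;
      the reversed factorizations fold the two composites back into \<open>U\<close> and
      \<open>V\<close>.\<close>
    by (rule bexI[OF _ A(2)], rule bexI[OF _ A(3)], unfold factor, rule A(1))
qed

lemma AUT_mult:
  assumes "(U, V, W) \<in> AUT G" "(U', V', W') \<in> AUT G"
  shows "(U \<otimes>\<^bsub>SYM G\<^esub> U', V \<otimes>\<^bsub>SYM G\<^esub> V', W \<otimes>\<^bsub>SYM G\<^esub> W') \<in> AUT G"
proof -
  interpret S: group "SYM G" by (rule SYM_group)
  show ?thesis
    using assms by (auto simp: AUT_def SYM_mult_apply m_closed SYM_closed)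
qed

lemma AUT_id: "(\<one>\<^bsub>SYM G\<^esub>, \<one>\<^bsub>SYM G\<^esub>, \<one>\<^bsub>SYM G\<^esub>) \<in> AUT G"
  using m_closed by (auto simp: AUT_def SYM_simps id_Bij)

lemma BS_iff: "\<theta> \<in> BS G \<longleftrightarrow> (\<exists>U V. (U, V, \<theta>) \<in> AUT G)"
proof -
  have "\<theta> \<in> carrier (SYM G)" "U \<one> \<in> carrier G" "V \<one> \<in> carrier G" if "(U, V, \<theta>) \<in> AUT G" for U V
    using that by (auto simp: AUT_def SYM_closed one_closed)
  then show ?thesis
    unfolding BS_def mem_Collect_eq BS_translations_iff[OF subset_refl] by blast
qed

lemma SBS_iff:
  assumes "K \<subseteq> carrier G"
  shows "\<theta> \<in> SBS G K \<longleftrightarrow>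
    (\<forall>h\<in>K. \<theta> h \<in> K) \<and> (\<exists>U V. (U, V, \<theta>) \<in> AUT G \<and> U \<one> \<in> K \<and> V \<one> \<in> K)"
  unfolding SBS_def SSYM_def mem_Collect_eq BS_translations_iff[OF assms]
  by (auto simp: AUT_def)

lemma SBS_subset_BS: "K \<subseteq> carrier G \<Longrightarrow> SBS G K \<subseteq> BS G"
  unfolding BS_def SBS_def SSYM_def by blast

section \<open>Subloops and the autotopisms that preserve them\<close>

lemma subloop_one:
  assumes "subloop K G"
  shows "\<one> \<in> K"
  using loop.one_closed[of "G\<lparr>carrier := K\<rparr>"] assms by (simp add: subloop_def)

text \<open>The quotient taken inside \<open>K\<close> also solves the equation in \<open>G\<close>,
  where solutions are unique.\<close>

lemma subloop_r_div:
  assumes "subloop K G" "g \<in> K" "x \<in> carrier G" "x \<otimes> g \<in> K"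
  shows "x \<in> K"
proof -
  have "K \<subseteq> carrier G" "loop (G\<lparr>carrier := K\<rparr>)"
    using assms(1) by (auto simp: subloop_def)
  then obtain y where "y \<in> K" "y \<otimes> g = x \<otimes> g"
    using loop.r_div[of "G\<lparr>carrier := K\<rparr>" g "x \<otimes> g"] assms by auto
  then show ?thesis
    using r_cancel[of g y x] assms \<open>K \<subseteq> carrier G\<close> by auto
qed

lemma subloop_l_div:
  assumes "subloop K G" "f \<in> K" "x \<in> carrier G" "f \<otimes> x \<in> K"
  shows "x \<in> K"
proof -
  have "K \<subseteq> carrier G" "loop (G\<lparr>carrier := K\<rparr>)"
    using assms(1) by (auto simp: subloop_def)
  then obtain y where "y \<in> K" "f \<otimes> y = f \<otimes> x"
    using loop.l_div[of "G\<lparr>carrier := K\<rparr>" f "f \<otimes> x"] assms by auto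
  then show ?thesis
    using l_cancel[of f y x] assms \<open>K \<subseteq> carrier G\<close> by auto
qed

text \<open>Both \<open>U x \<otimes> V \<one>\<close> and \<open>U \<one> \<otimes> V x\<close>
  equal \<open>\<theta> x\<close>, an element of \<open>K\<close>; dividing by
  \<open>V \<one>\<close> and \<open>U \<one>\<close>, also in \<open>K\<close>, leaves
  \<open>U x\<close> and \<open>V x\<close> in \<open>K\<close>.\<close>

lemma AUT_preserves_subloop:
  assumes K: "subloop K G" and A: "(U, V, \<theta>) \<in> AUT G"
    and \<theta>: "\<forall>h\<in>K. \<theta> h \<in> K" and "U \<one> \<in> K" "V \<one> \<in> K" and x: "x \<in> K"
  shows "U x \<in> K" "V x \<in> K"
proof -
  have xG: "x \<in> carrier G"
    using K x by (auto simp: subloop_def)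
  have UV: "U \<in> carrier (SYM G)" "V \<in> carrier (SYM G)"
    and "U x \<otimes> V \<one> = \<theta> (x \<otimes> \<one>)" "U \<one> \<otimes> V x = \<theta> (\<one> \<otimes> x)"
    using A xG one_closed by (auto simp: AUT_def)
  then have "U x \<otimes> V \<one> \<in> K" "U \<one> \<otimes> V x \<in> K"
    using bspec[OF \<theta> x] xG by (simp_all add: l_one r_one)
  then show "U x \<in> K" "V x \<in> K"
    by (blast intro: subloop_r_div[OF K \<open>V \<one> \<in> K\<close> SYM_closed[OF UV(1) xG]]
      subloop_l_div[OF K \<open>U \<one> \<in> K\<close> SYM_closed[OF UV(2) xG]])+
qed

section \<open>Subgroup property and Lagrange's theorem\<close>

lemma BS_subgroup:
  assumes "finite (carrier G)"
  shows "subgroup (BS G) (SYM G)"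
proof (rule group.finite_closed_imp_subgroup[OF SYM_group])
  show sub: "BS G \<subseteq> carrier (SYM G)"
    by (auto simp: BS_def)
  show "finite (BS G)"
    using finite_subset[OF sub finite_SYM[OF assms]] .
  show "BS G \<noteq> {}"
    using AUT_id BS_iff by blast
  show "\<theta> \<otimes>\<^bsub>SYM G\<^esub> \<phi> \<in> BS G" if "\<theta> \<in> BS G" "\<phi> \<in> BS G" for \<theta> \<phi>
    using that AUT_mult by (metis BS_iff)
qed

lemma SBS_subgroup:
  assumes "finite (carrier G)" and K: "subloop K G"
  shows "subgroup (SBS G K) (SYM G)"
proof (rule group.finite_closed_imp_subgroup[OF SYM_group])
  have KG: "K \<subseteq> carrier G"
    using K by (simp add: subloop_def)
  show sub: "SBS G K \<subseteq> carrier (SYM G)"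
    by (auto simp: SBS_def SSYM_def)
  show "finite (SBS G K)"
    using finite_subset[OF sub finite_SYM[OF assms(1)]] .
  have "\<one>\<^bsub>SYM G\<^esub> h \<in> K" if "h \<in> K" for h
    using that subsetD[OF KG that] by (simp add: SYM_simps)
  then have "\<one>\<^bsub>SYM G\<^esub> \<in> SBS G K"
    unfolding SBS_iff[OF KG] using AUT_id subloop_one[OF K] by blast
  then show "SBS G K \<noteq> {}" by blast
  show "\<theta> \<otimes>\<^bsub>SYM G\<^esub> \<phi> \<in> SBS G K" if \<theta>: "\<theta> \<in> SBS G K" and \<phi>: "\<phi> \<in> SBS G K" for \<theta> \<phi>
  proof -
    obtain U V where UV: "(U, V, \<theta>) \<in> AUT G" "U \<one> \<in> K" "V \<one> \<in> K"
      using \<theta> by (auto simp: SBS_iff[OF KG])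
    obtain U' V' where UV': "(U', V', \<phi>) \<in> AUT G" "U' \<one> \<in> K" "V' \<one> \<in> K"
      using \<phi> by (auto simp: SBS_iff[OF KG])
    have \<phi>_K: "\<forall>h\<in>K. \<phi> h \<in> K"
      using \<phi> by (simp add: SBS_iff[OF KG])
    \<comment> \<open>The composite autotopism sends \<open>\<one>\<close> to
      \<open>U' (U \<one>)\<close> and \<open>V' (V \<one>)\<close>, so the maps \<open>U'\<close>
      and \<open>V'\<close> of the second factor must keep \<open>K\<close> invariant.\<close>
    note preserves = AUT_preserves_subloop[OF K UV'(1) \<phi>_K UV'(2,3)]
    have "U' (U \<one>) \<in> K" "V' (V \<one>) \<in> K"
      using preserves(1)[OF UV(2)] preserves(2)[OF UV(3)] .
    moreover have "(\<theta> \<otimes>\<^bsub>SYM G\<^esub> \<phi>) h \<in> K" if "h \<in> K" for h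
      using that \<theta> \<phi> subsetD[OF KG that] by (simp add: SBS_iff[OF KG] SYM_mult_apply)
    ultimately show ?thesis
      unfolding SBS_iff[OF KG] using AUT_mult[OF UV(1) UV'(1)]
      by (metis SYM_mult_apply one_closed)
  qed
qed

lemma card_SBS_mult_index:
  assumes "finite (carrier G)" "subloop K G"
  shows "card (SBS G K) * subgroup_index (BS_group G) (SBS G K) = order (BS_group G)"
proof -
  have "group (BS_group G)"
    unfolding BS_group_def
    by (rule subgroup.subgroup_is_group[OF BS_subgroup[OF assms(1)] SYM_group])
  moreover have "subgroup (SBS G K) (BS_group G)"
    unfolding BS_group_def using assms
    by (intro group.subgroup_incl SYM_group SBS_subgroup BS_subgroup SBS_subset_BS)
      (auto simp: subloop_def)
  ultimately show ?thesis
    using group.lagrange by (metis subgroup_index_def mult.commute)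
qed

end

theorem theorem3p6:
  fixes G :: "('a, 'b) monoid_scheme" and H :: "nat \<Rightarrow> 'a set" and n :: nat
  assumes "S_loop G"
    and "finite (carrier G)"
    and "n \<ge> 1"
    and "\<And>i. i \<in> {1..n} \<Longrightarrow> S_subgroup (H i) G"
    and "inj_on H {1..n}"
  shows "real (order (BS_group G)) =
    1 / real n *
      (\<Sum>i = 1..n. real (card (SBS G (H i))) * real (subgroup_index (BS_group G) (SBS G (H i))))"
proof -
  have "loop G"
    using assms(1) by (simp add: S_loop_def)
  then have "real (card (SBS G (H i))) * real (subgroup_index (BS_group G) (SBS G (H i))) =
      real (order (BS_group G))" if "i \<in> {1..n}" for i
    using loop.card_SBS_mult_index[of G "H i"] assms(2) assms(4)[OF that]
    by (simp add: S_subgroup_def flip: of_nat_mult)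
  \<comment> \<open>The sum has \<open>n\<close> equal terms, and \<open>n \<ge> 1\<close> lets the
    factor \<open>n\<close> cancel.\<close>
  then show ?thesis
    using assms(3) by simp
qed

end
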